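(* For all positive integers $a\leq b$, the complete bipartite graph $K_{a,b}$ satisfies \[\tfrac{1}{2}(a+b-1)\;\leq\;\operatorname{sn}(K_{a,b})\;\leq\;\min\Big\{b,\ \big\lceil \tfrac{b}{2}\big\rceil+a-1\Big\}.\]
   Context: A (straight-line) drawing of a graph maps its vertices to distinct points in the plane and represents each edge by the closed line segment between its endpoints, such that each edge segment intersects no vertex other than its own endpoints. The slope of an edge is the angle in $[0,\pi)$ from the $x$-axis to the line containing it. The slope-number $\operatorname{sn}(G)$ is the minimum number of distinct edge slopes over all drawings of $G$. *)

theory Defs
  imports "HOL-Analysis.Analysis"
begin

text \<open>
  A graph is given by its vertex set \<open>V\<close> and its set \<open>E\<close> of edges, each edge being
  a two-element subset of \<open>V\<close>.
\<close>

definition is_drawing :: "'v set \<Rightarrow> 'v set set \<Rightarrow> ('v \<Rightarrow> real \<times> real) \<Rightarrow> bool" where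
  "is_drawing V E \<phi> \<longleftrightarrow>
     inj_on \<phi> V \<and>
     (\<forall>u v w. {u, v} \<in> E \<longrightarrow> w \<in> V \<longrightarrow>
        \<phi> w \<in> closed_segment (\<phi> u) (\<phi> v) \<longrightarrow> w = u \<or> w = v)"

definition line_angle :: "(real \<times> real) set \<Rightarrow> real" where
  "line_angle L =
     (THE \<theta>. 0 \<le> \<theta> \<and> \<theta> < pi \<and>
        (\<exists>p. L = range (\<lambda>t. p + t *\<^sub>R (cos \<theta>, sin \<theta>))))"

definition slope :: "real \<times> real \<Rightarrow> real \<times> real \<Rightarrow> real" where
  "slope p q = line_angle (affine hull {p, q})"

definition slopes :: "'v set set \<Rightarrow> ('v \<Rightarrow> real \<times> real) \<Rightarrow> real set" where
  "slopes E \<phi> = {slope (\<phi> u) (\<phi> v) | u v. {u, v} \<in> E}"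

text \<open>
  For a finite graph the set below is nonempty and all sets \<open>slopes E \<phi>\<close> are finite, so that
  this infimum of natural numbers is a minimum.
\<close>

definition slope_number :: "'v set \<Rightarrow> 'v set set \<Rightarrow> nat" where
  "slope_number V E = Inf {card (slopes E \<phi>) | \<phi>. is_drawing V E \<phi>}"

definition K_verts :: "nat \<Rightarrow> nat \<Rightarrow> (nat + nat) set" where
  "K_verts a b = {..<a} <+> {..<b}"

definition K_edges :: "nat \<Rightarrow> nat \<Rightarrow> (nat + nat) set set" where
  "K_edges a b = {{Inl i, Inr j} | i j. i < a \<and> j < b}"

text \<open>The definite description in \<open>line_angle\<close> is well defined on lines.\<close>

lemma line_angle_unique:
  fixes p q :: "real \<times> real"
  assumes "0 \<le> \<theta>" "\<theta> < pi" "0 \<le> \<theta>'" "\<theta>' < pi"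
    and eq: "range (\<lambda>t. p + t *\<^sub>R (cos \<theta>, sin \<theta>)) = range (\<lambda>t. q + t *\<^sub>R (cos \<theta>', sin \<theta>'))"
  shows "\<theta> = \<theta>'"
proof -
  have "p + 0 *\<^sub>R (cos \<theta>, sin \<theta>) \<in> range (\<lambda>t. q + t *\<^sub>R (cos \<theta>', sin \<theta>'))"
    and "p + 1 *\<^sub>R (cos \<theta>, sin \<theta>) \<in> range (\<lambda>t. q + t *\<^sub>R (cos \<theta>', sin \<theta>'))"
    unfolding eq[symmetric] by (rule rangeI)+
  then obtain s r where s: "p = q + s *\<^sub>R (cos \<theta>', sin \<theta>')"
    and r: "p + (cos \<theta>, sin \<theta>) = q + r *\<^sub>R (cos \<theta>', sin \<theta>')"
    unfolding image_iff by (metis add_0_right scaleR_one scaleR_zero_left)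
  have "(cos \<theta>, sin \<theta>) = (r - s) *\<^sub>R (cos \<theta>', sin \<theta>')"
    using s r by (simp add: prod_eq_iff algebra_simps)
  then have "sin (\<theta> - \<theta>') = 0"
    by (simp add: sin_diff)
  moreover have "\<bar>\<theta> - \<theta>'\<bar> < pi" using assms by linarith
  ultimately show ?thesis
    using sin_eq_0_pi[of "\<theta> - \<theta>'"] by (auto simp: abs_less_iff)
qed

lemma line_angle_exists:
  fixes p q :: "real \<times> real"
  assumes "p \<noteq> q"
  shows "\<exists>\<theta>. 0 \<le> \<theta> \<and> \<theta> < pi \<and> affine hull {p, q} = range (\<lambda>t. p + t *\<^sub>R (cos \<theta>, sin \<theta>))"
proof -
  obtain x y where xy: "q - p = (x, y)" by (cases "q - p")
  define z where "z = Complex x y"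
  have "z \<noteq> 0" using assms xy by (auto simp: z_def complex_eq_iff prod_eq_iff)
  define \<alpha> where "\<alpha> = Arg z"
  have \<alpha>: "-pi < \<alpha>" "\<alpha> \<le> pi" using Arg_bounded[of z] by (auto simp: \<alpha>_def)
  have z: "z = cmod z *\<^sub>R cis \<alpha>"
    using rcis_cmod_Arg[of z] by (simp add: \<alpha>_def rcis_def scaleR_conv_of_real)
  define \<theta> where "\<theta> = (if \<alpha> < 0 then \<alpha> + pi else if \<alpha> = pi then 0 else \<alpha>)"
  define c where "c = (if \<alpha> < 0 \<or> \<alpha> = pi then - cmod z else cmod z)"
  have "z = c *\<^sub>R cis \<theta>"
    by (subst z) (auto simp: c_def \<theta>_def complex_eq_iff)
  then have c: "q - p = c *\<^sub>R (cos \<theta>, sin \<theta>)"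
    using xy by (simp add: z_def complex_eq_iff)
  have "c \<noteq> 0" using \<open>z \<noteq> 0\<close> by (simp add: c_def)
  have \<theta>: "0 \<le> \<theta>" "\<theta> < pi" using \<alpha> by (auto simp: \<theta>_def)
  have "affine hull {p, q} = range (\<lambda>t. p + t *\<^sub>R (q - p))"
    by (auto simp: affine_hull_2_alt)
  also have "\<dots> = range (\<lambda>t. p + t *\<^sub>R (cos \<theta>, sin \<theta>))"
  proof (intro equalityI subsetI)
    fix w assume "w \<in> range (\<lambda>t. p + t *\<^sub>R (q - p))"
    then obtain t where "w = p + t *\<^sub>R (q - p)" by blast
    then have "w = p + (t * c) *\<^sub>R (cos \<theta>, sin \<theta>)" by (simp add: c)
    then show "w \<in> range (\<lambda>t. p + t *\<^sub>R (cos \<theta>, sin \<theta>))" by blast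
  next
    fix w assume "w \<in> range (\<lambda>t. p + t *\<^sub>R (cos \<theta>, sin \<theta>))"
    then obtain t where "w = p + t *\<^sub>R (cos \<theta>, sin \<theta>)" by blast
    then have "w = p + (t / c) *\<^sub>R (q - p)" using \<open>c \<noteq> 0\<close> by (simp add: c)
    then show "w \<in> range (\<lambda>t. p + t *\<^sub>R (q - p))" by blast
  qed
  finally show ?thesis using \<theta> by blast
qed

end

theory Submission
  imports Defs
begin

text \<open>
  Lower bound. If a finite set \<open>P\<close> lies to the left of a finite set \<open>Q\<close> and no segment between
  them contains a third point, then the segment of least gradient is the only one of that gradient;
  deleting one of its endpoints and inducting yields at least \<open>|P| + |Q| - 1\<close> gradients.
  Take coordinates in which all vertices have distinct abscissae, and let \<open>v\<close> be the leftmost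
  vertex of the class of size \<open>a\<close>. If \<open>l\<close> and \<open>r\<close> vertices of the other class lie to the left and
  to the right of \<open>v\<close>, there are at least \<open>r\<close> slopes at \<open>v\<close> and at least \<open>l + a - 1\<close> slopes
  (if \<open>l > 0\<close>) between the \<open>l\<close> vertices and the first class; now add \<open>l + r = b\<close>.

  Upper bounds. Alternating the two classes around a regular \<open>2b\<close>-gon gives \<open>b\<close> slopes. Placing
  the first class on a vertical line and the two halves of the second class on parallel lines at
  distance one on either side, all at integer heights, gives the other bound.
\<close>

section \<open>Slopes and parallel segments\<close>

lemma slope_eqI:
  assumes "0 \<le> \<theta>" "\<theta> < pi" "c \<noteq> 0" and c: "q - p = c *\<^sub>R (cos \<theta>, sin \<theta>)"
  shows "slope p q = \<theta>"
proof -
  have hull: "affine hull {p, q} = range (\<lambda>t. p + t *\<^sub>R (cos \<theta>, sin \<theta>))"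
  proof -
    have "affine hull {p, q} = range (\<lambda>t. p + t *\<^sub>R (q - p))"
      by (auto simp: affine_hull_2_alt)
    also have "\<dots> = range (\<lambda>t. p + t *\<^sub>R (cos \<theta>, sin \<theta>))"
    proof (intro equalityI subsetI)
      fix w assume "w \<in> range (\<lambda>t. p + t *\<^sub>R (q - p))"
      then obtain t where "w = p + t *\<^sub>R (q - p)" by blast
      then have "w = p + (t * c) *\<^sub>R (cos \<theta>, sin \<theta>)" by (simp add: c)
      then show "w \<in> range (\<lambda>t. p + t *\<^sub>R (cos \<theta>, sin \<theta>))" by blast
    next
      fix w assume "w \<in> range (\<lambda>t. p + t *\<^sub>R (cos \<theta>, sin \<theta>))"
      then obtain t where "w = p + t *\<^sub>R (cos \<theta>, sin \<theta>)" by blast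
      then have "w = p + (t / c) *\<^sub>R (q - p)" using \<open>c \<noteq> 0\<close> by (simp add: c)
      then show "w \<in> range (\<lambda>t. p + t *\<^sub>R (q - p))" by blast
    qed
    finally show ?thesis .
  qed
  show ?thesis
    unfolding slope_def line_angle_def
  proof (rule the_equality)
    show "0 \<le> \<theta> \<and> \<theta> < pi \<and>
        (\<exists>x. affine hull {p, q} = range (\<lambda>t. x + t *\<^sub>R (cos \<theta>, sin \<theta>)))"
      using assms hull by blast
    show "\<eta> = \<theta>" if "0 \<le> \<eta> \<and> \<eta> < pi \<and>
        (\<exists>x. affine hull {p, q} = range (\<lambda>t. x + t *\<^sub>R (cos \<eta>, sin \<eta>)))" for \<eta>
      using that hull assms line_angle_unique by metis
  qed
qed

lemma slope_direction:
  assumes "p \<noteq> q"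
  obtains c where "c \<noteq> 0" "q - p = c *\<^sub>R (cos (slope p q), sin (slope p q))"
    "0 \<le> slope p q" "slope p q < pi"
proof -
  obtain \<theta> where \<theta>: "0 \<le> \<theta>" "\<theta> < pi"
      "affine hull {p, q} = range (\<lambda>t. p + t *\<^sub>R (cos \<theta>, sin \<theta>))"
    using line_angle_exists[OF assms] by blast
  have "q \<in> affine hull {p, q}" by (simp add: hull_inc)
  then obtain c where "q = p + c *\<^sub>R (cos \<theta>, sin \<theta>)" using \<theta> by blast
  then have c: "q - p = c *\<^sub>R (cos \<theta>, sin \<theta>)" by simp
  have "c \<noteq> 0" using c assms by (metis right_minus_eq scaleR_zero_left)
  with c \<theta> slope_eqI that show thesis by metis
qed

lemma slope_commute: "slope p q = slope q p"
  by (simp add: slope_def insert_commute)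

text \<open>The factor \<open>d\<close> may be negative because a slope belongs to an undirected
  line. Slopes can thus be compared without computing any angle.\<close>

lemma slope_parallel:
  assumes "p \<noteq> q" "d \<noteq> 0" "s - r = d *\<^sub>R (q - p)"
  shows "slope r s = slope p q"
proof -
  obtain c where c: "c \<noteq> 0" "q - p = c *\<^sub>R (cos (slope p q), sin (slope p q))"
      "0 \<le> slope p q" "slope p q < pi"
    using slope_direction[OF assms(1)] .
  have "s - r = (d * c) *\<^sub>R (cos (slope p q), sin (slope p q))"
    using assms(3) c(2) by (metis scaleR_scaleR)
  moreover have "d * c \<noteq> 0" using c(1) assms(2) by simp
  ultimately show ?thesis
    using slope_eqI[OF c(3,4)] by blast
qed

lemma slope_number_le:
  assumes "is_drawing V E \<phi>"
  shows "slope_number V E \<le> card (slopes E \<phi>)"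
  unfolding slope_number_def by (rule cInf_lower) (use assms in auto)

text \<open>A nonempty set of naturals contains its infimum; the given drawing only witnesses
  nonemptiness.\<close>

lemma slope_number_attained:
  assumes "is_drawing V E \<phi>"
  obtains \<psi> where "is_drawing V E \<psi>" "slope_number V E = card (slopes E \<psi>)"
proof -
  have "slope_number V E \<in> {card (slopes E \<phi>) | \<phi>. is_drawing V E \<phi>}"
    unfolding slope_number_def by (rule Inf_nat_def1) (use assms in auto)
  then show thesis using that by blast
qed

lemma K_edge_iff:
  "{u, v} \<in> K_edges a b \<longleftrightarrow>
     (\<exists>i<a. \<exists>j<b. u = Inl i \<and> v = Inr j \<or> u = Inr j \<and> v = Inl i)"
  unfolding K_edges_def by (auto simp: doubleton_eq_iff)

lemma slopes_K_edges:
  "slopes (K_edges a b) \<phi> =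
     (\<lambda>(i, j). slope (\<phi> (Inl i)) (\<phi> (Inr j))) ` ({..<a} \<times> {..<b})"
proof (intro equalityI subsetI)
  fix s assume "s \<in> slopes (K_edges a b) \<phi>"
  then obtain i j where "i < a" "j < b" "s = slope (\<phi> (Inl i)) (\<phi> (Inr j))"
    unfolding slopes_def K_edge_iff using slope_commute by blast
  then show "s \<in> (\<lambda>(i, j). slope (\<phi> (Inl i)) (\<phi> (Inr j))) ` ({..<a} \<times> {..<b})" by auto
qed (auto simp: slopes_def K_edge_iff)

text \<open>The second premise compares points instead of vertices, so it can be checked by plane
  geometry alone; injectivity then recovers the vertices.\<close>

lemma is_drawing_K_I:
  assumes "inj_on \<phi> (K_verts a b)"
    and "\<And>i j w. i < a \<Longrightarrow> j < b \<Longrightarrow> w \<in> K_verts a b \<Longrightarrow>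
      \<phi> w \<in> closed_segment (\<phi> (Inl i)) (\<phi> (Inr j)) \<Longrightarrow> \<phi> w = \<phi> (Inl i) \<or> \<phi> w = \<phi> (Inr j)"
  shows "is_drawing (K_verts a b) (K_edges a b) \<phi>"
proof -
  have *: "w = Inl i \<or> w = Inr j" if "i < a" "j < b" "w \<in> K_verts a b"
    "\<phi> w \<in> closed_segment (\<phi> (Inl i)) (\<phi> (Inr j))" for i j w
    using assms(2)[OF that] inj_onD[OF assms(1)] that by (auto simp: K_verts_def)
  show ?thesis
    unfolding is_drawing_def K_edge_iff
    using assms(1) * closed_segment_commute by metis
qed

section \<open>The lower bound\<close>

definition gradient :: "('v \<Rightarrow> real) \<Rightarrow> ('v \<Rightarrow> real) \<Rightarrow> 'v \<Rightarrow> 'v \<Rightarrow> real" where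
  "gradient X Y u v = (Y v - Y u) / (X v - X u)"

lemma gradient_commute: "gradient X Y u v = gradient X Y v u"
  unfolding gradient_def by (metis minus_diff_eq minus_divide_divide)

lemma gradient_times:
  "X u \<noteq> X v \<Longrightarrow> Y v - Y u = gradient X Y u v * (X v - X u)"
  by (simp add: gradient_def)

text \<open>\<open>ncP\<close> and \<open>ncQ\<close> replace the absence of a third point on a
  segment. Two pairs of minimal gradient force the mixed pair \<open>p'\<close>, \<open>q\<close> to
  have that gradient too, and then \<open>ncP\<close> and \<open>ncQ\<close> identify the
  endpoints.\<close>

lemma unique_minimal_gradient:
  fixes X Y :: "'v \<Rightarrow> real"
  assumes sep: "\<And>p q. p \<in> P \<Longrightarrow> q \<in> Q \<Longrightarrow> X p < X q"
    and ncP: "\<And>p p' q. p \<in> P \<Longrightarrow> p' \<in> P \<Longrightarrow> q \<in> Q \<Longrightarrow>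
      gradient X Y p q = gradient X Y p' q \<Longrightarrow> p = p'"
    and ncQ: "\<And>p q q'. p \<in> P \<Longrightarrow> q \<in> Q \<Longrightarrow> q' \<in> Q \<Longrightarrow>
      gradient X Y p q = gradient X Y p q' \<Longrightarrow> q = q'"
    and p: "p \<in> P" and q: "q \<in> Q" and p': "p' \<in> P" and q': "q' \<in> Q"
    and min: "\<And>r s. r \<in> P \<Longrightarrow> s \<in> Q \<Longrightarrow> gradient X Y p q \<le> gradient X Y r s"
    and eq: "gradient X Y p' q' = gradient X Y p q"
  shows "p' = p \<and> q' = q"
proof -
  define m where "m = gradient X Y p q"
  have ge: "m * (X s - X r) \<le> Y s - Y r" if "r \<in> P" "s \<in> Q" for r s
    using min[OF that] sep[OF that] by (simp add: m_def gradient_def[of X Y r s] field_simps)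
  have 1: "Y q - Y p = m * (X q - X p)" and 2: "Y q' - Y p' = m * (X q' - X p')"
    using gradient_times[of X p q Y] gradient_times[of X p' q' Y] sep p q p' q' eq
    by (force simp: m_def)+
  \<comment> \<open>The mixed pairs have the same total rise and total run as the two minimal pairs.
    Their two lower bounds add up to an equality, so neither is strict.\<close>
  have "Y q - Y p' = m * (X q - X p')"
    using ge[OF p' q] ge[OF p q'] 1 2 by (simp add: algebra_simps)
  then have "gradient X Y p' q = m"
    using sep[OF p' q] by (simp add: gradient_def)
  then have "gradient X Y p q = gradient X Y p' q" "gradient X Y p' q = gradient X Y p' q'"
    using eq by (simp_all add: m_def)
  then show ?thesis
    using ncP[OF p p' q] ncQ[OF p' q q'] by blast
qed

lemma card_gradients_separated:
  fixes X Y :: "'v \<Rightarrow> real"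
  assumes "finite P" "finite Q" "P \<noteq> {}" "Q \<noteq> {}"
    and "\<And>p q. p \<in> P \<Longrightarrow> q \<in> Q \<Longrightarrow> X p < X q"
    and "\<And>p p' q. p \<in> P \<Longrightarrow> p' \<in> P \<Longrightarrow> q \<in> Q \<Longrightarrow>
      gradient X Y p q = gradient X Y p' q \<Longrightarrow> p = p'"
    and "\<And>p q q'. p \<in> P \<Longrightarrow> q \<in> Q \<Longrightarrow> q' \<in> Q \<Longrightarrow>
      gradient X Y p q = gradient X Y p q' \<Longrightarrow> q = q'"
  shows "card P + card Q \<le> Suc (card ((\<lambda>(p, q). gradient X Y p q) ` (P \<times> Q)))"
  using assms
proof (induction "card P + card Q" arbitrary: P Q rule: less_induct)
  case less
  let ?G = "\<lambda>P Q. (\<lambda>(p, q). gradient X Y p q) ` (P \<times> Q)"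
  have fin: "finite (?G P Q)" and ne: "?G P Q \<noteq> {}"
    using less.prems(1-4) by auto
  obtain p q where p: "p \<in> P" and q: "q \<in> Q" and m: "gradient X Y p q = Min (?G P Q)"
    using Min_in[OF fin ne] by auto
  have min: "gradient X Y p q \<le> gradient X Y r s" if "r \<in> P" "s \<in> Q" for r s
    unfolding m using that by (intro Min_le fin) auto
  have uniq: "p' = p \<and> q' = q"
    if "p' \<in> P" "q' \<in> Q" "gradient X Y p' q' = gradient X Y p q" for p' q'
    using unique_minimal_gradient[of P Q X Y p q p' q'] less.prems(5-7) p q that min by blast
  \<comment> \<open>Only the pair \<open>p\<close>, \<open>q\<close> realises the minimum, so
    removing either endpoint loses a gradient.\<close>
  have step: "Suc (card (?G P' Q')) \<le> card (?G P Q)"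
    if "P' \<subseteq> P" "Q' \<subseteq> Q" "p \<notin> P' \<or> q \<notin> Q'" for P' Q'
  proof -
    have "?G P' Q' \<subseteq> ?G P Q - {gradient X Y p q}"
      using that uniq by fastforce
    moreover have "gradient X Y p q \<in> ?G P Q" using p q by auto
    ultimately have "?G P' Q' \<subset> ?G P Q" by blast
    then show ?thesis using psubset_card_mono[OF fin] by (simp add: Suc_leI)
  qed
  have IH: "card P' + card Q' \<le> Suc (card (?G P' Q'))"
    if "P' \<subseteq> P" "Q' \<subseteq> Q" "P' \<noteq> {}" "Q' \<noteq> {}" "card P' + card Q' < card P + card Q" for P' Q'
  proof (rule less.hyps[OF that(5)])
    show "finite P'" "finite Q'" using less.prems(1,2) that finite_subset by auto
    show "P' \<noteq> {}" "Q' \<noteq> {}" by (fact that)+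
    show "X r < X s" if "r \<in> P'" "s \<in> Q'" for r s
      using less.prems(5) that \<open>P' \<subseteq> P\<close> \<open>Q' \<subseteq> Q\<close> by blast
    show "r = r'" if "r \<in> P'" "r' \<in> P'" "s \<in> Q'" "gradient X Y r s = gradient X Y r' s" for r r' s
      using less.prems(6)[OF _ _ _ that(4)] that \<open>P' \<subseteq> P\<close> \<open>Q' \<subseteq> Q\<close> by blast
    show "s = s'" if "r \<in> P'" "s \<in> Q'" "s' \<in> Q'" "gradient X Y r s = gradient X Y r s'" for r s s'
      using less.prems(7)[OF _ _ _ that(4)] that \<open>P' \<subseteq> P\<close> \<open>Q' \<subseteq> Q\<close> by blast
  qed
  show ?case
  \<comment> \<open>The endpoint is deleted from a set that stays nonempty. If both sets are
    singletons, the bound reads 2 \<le> 2.\<close>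
  proof (cases "P = {p}")
    case True
    show ?thesis
    proof (cases "Q = {q}")
      case True
      then show ?thesis using \<open>P = {p}\<close> by simp
    next
      case False
      have c: "card Q = Suc (card (Q - {q}))"
        using card.remove[OF less.prems(2) q] .
      have "Q - {q} \<noteq> {}" using False q by blast
      then show ?thesis
        using IH[of P "Q - {q}"] step[of P "Q - {q}"] c p by force
    qed
  next
    case False
    have c: "card P = Suc (card (P - {p}))"
      using card.remove[OF less.prems(1) p] .
    have "P - {p} \<noteq> {}" using False p by blast
    then show ?thesis
      using IH[of "P - {p}" Q] step[of "P - {p}" Q] c q by force
  qed
qed

text \<open>Each pair of points with different ordinates rules out one value of \<open>c\<close>,
  and finitely many values do not exhaust the reals. Points with equal ordinates are separated by
  every shear.\<close>

lemma generic_shear: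
  fixes P :: "(real \<times> real) set"
  assumes "finite P"
  obtains c where "inj_on (\<lambda>p. fst p + c * snd p) P"
proof -
  \<comment> \<open>Pairs with equal ordinates divide by zero here, which merely excludes the value
    0 as well.\<close>
  let ?F = "(\<lambda>(p, q). - (fst p - fst q) / (snd p - snd q)) ` (P \<times> P)"
  have "finite ?F" using assms by simp
  then obtain c where c: "c \<notin> ?F"
    using ex_new_if_finite[OF infinite_UNIV_char_0] by blast
  have "inj_on (\<lambda>p. fst p + c * snd p) P"
  proof (rule inj_onI)
    fix p q assume pq: "p \<in> P" "q \<in> P" "fst p + c * snd p = fst q + c * snd q"
    have "snd p = snd q"
    proof (rule ccontr)
      assume "snd p \<noteq> snd q"
      then have "c = - (fst p - fst q) / (snd p - snd q)"
        using pq(3) by (simp add: field_simps)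
      with c pq show False by (force simp: image_iff)
    qed
    with pq(3) show "p = q" by (simp add: prod_eq_iff)
  qed
  with that show thesis .
qed

section \<open>From gradients to slopes of a drawing\<close>

lemma slopes_K_lower_bound:
  assumes "1 \<le> a" "a \<le> b" and dr: "is_drawing (K_verts a b) (K_edges a b) \<phi>"
  shows "a + b \<le> Suc (2 * card (slopes (K_edges a b) \<phi>))"
proof -
  let ?V = "K_verts a b" and ?E = "K_edges a b"
  let ?A = "Inl ` {..<a} :: (nat + nat) set" and ?B = "Inr ` {..<b} :: (nat + nat) set"
  have V: "?V = ?A \<union> ?B" by (auto simp: K_verts_def)
  have inj: "inj_on \<phi> ?V" using dr by (simp add: is_drawing_def)
  have edge: "{u, v} \<in> ?E" if "u \<in> ?A" "v \<in> ?B" for u v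
    using that by (auto simp: K_edge_iff)
  have avoid: "w = u \<or> w = v"
    if "{u, v} \<in> ?E" "w \<in> ?V" "\<phi> w \<in> closed_segment (\<phi> u) (\<phi> v)" for u v w
    using dr that by (auto simp: is_drawing_def)
  obtain c where c: "inj_on (\<lambda>p. fst p + c * snd p) (\<phi> ` ?V)"
    using generic_shear[of "\<phi> ` ?V"] by (auto simp: V)
  \<comment> \<open>Only the abscissa is sheared: distinct vertices get distinct abscissae, and the
    unchanged ordinate makes the shear easy to undo.\<close>
  define X where "X v = fst (\<phi> v) + c * snd (\<phi> v)" for v
  define Y where "Y v = snd (\<phi> v)" for v
  let ?m = "gradient X Y" and ?S = "slopes ?E \<phi>"
  have Xinj: "X u = X v \<Longrightarrow> u = v" if "u \<in> ?V" "v \<in> ?V" for u v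
    using inj_onD[OF c, of "\<phi> u" "\<phi> v"] inj_onD[OF inj, of u v] that by (auto simp: X_def)
  have finS: "finite ?S" by (simp add: slopes_K_edges)
  \<comment> \<open>\<open>g\<close> gives the gradient, in sheared coordinates, of a line with
    angle \<theta>. Gradients of edges are therefore determined by slopes, so there are at most as
    many of them.\<close>
  define g where "g \<theta> = sin \<theta> / (cos \<theta> + c * sin \<theta>)" for \<theta> :: real
  have m_slope: "?m u v \<in> g ` ?S" if e: "{u, v} \<in> ?E" and ne: "\<phi> u \<noteq> \<phi> v" for u v
  proof -
    obtain d where d: "d \<noteq> 0"
        "\<phi> v - \<phi> u = d *\<^sub>R (cos (slope (\<phi> u) (\<phi> v)), sin (slope (\<phi> u) (\<phi> v)))"
      using slope_direction[OF ne] .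
    define \<theta> where "\<theta> = slope (\<phi> u) (\<phi> v)"
    have "fst (\<phi> v) - fst (\<phi> u) = d * cos \<theta>" "snd (\<phi> v) - snd (\<phi> u) = d * sin \<theta>"
      using arg_cong[OF d(2), of fst] arg_cong[OF d(2), of snd] by (simp_all add: \<theta>_def)
    then have "Y v - Y u = d * sin \<theta>" "X v - X u = d * (cos \<theta> + c * sin \<theta>)"
      by (simp_all add: X_def Y_def algebra_simps)
    then have "?m u v = g \<theta>" using d(1) by (simp add: gradient_def g_def)
    then show ?thesis using e by (auto simp: \<theta>_def slopes_def)
  qed
  have m_slopes: "card ((\<lambda>(p, q). ?m p q) ` (P \<times> Q)) \<le> card ?S"
    if "\<And>p q. p \<in> P \<Longrightarrow> q \<in> Q \<Longrightarrow> {p, q} \<in> ?E" for P Q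
  proof -
    have "(\<lambda>(p, q). ?m p q) ` (P \<times> Q) \<subseteq> g ` ?S"
    proof clarify
      fix p q assume "p \<in> P" "q \<in> Q"
      then have e: "{p, q} \<in> ?E" by (rule that)
      then have "p \<in> ?V" "q \<in> ?V" "p \<noteq> q" by (auto simp: K_edge_iff K_verts_def)
      then show "?m p q \<in> g ` ?S" using m_slope[OF e] inj_onD[OF inj] by blast
    qed
    then show ?thesis
      using card_mono[of "g ` ?S"] card_image_le[OF finS, of g] finS by (meson finite_imageI le_trans)
  qed
  \<comment> \<open>The ratio of abscissae is the parameter of \<open>w\<close> on the line through
    \<open>u\<close> and \<open>v\<close>. Equal gradients carry it over to the ordinates, and
    undoing the shear puts \<open>w\<close> on the segment itself.\<close>
  have between: "w = u \<or> w = v"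
    if "{u, v} \<in> ?E" "w \<in> ?V" "X u \<noteq> X v" "?m u v = ?m u w" 
      "X u \<noteq> X w" "0 \<le> (X w - X u) / (X v - X u)" "(X w - X u) / (X v - X u) \<le> 1" for u v w
  proof (rule avoid[OF that(1,2)])
    define t where "t = (X w - X u) / (X v - X u)"
    have X: "X w = X u + t * (X v - X u)" using that(3) by (simp add: t_def)
    have "Y w - Y u = ?m u v * (X w - X u)" using gradient_times[of X u w Y] that by simp
    also have "\<dots> = t * (Y v - Y u)" using gradient_times[of X u v Y] that(3) by (simp add: X)
    finally have Y: "snd (\<phi> w) = snd (\<phi> u) + t * (snd (\<phi> v) - snd (\<phi> u))" by (simp add: Y_def)
    have "fst (\<phi> w) = fst (\<phi> u) + t * (fst (\<phi> v) - fst (\<phi> u))"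
      using X unfolding X_def Y by (simp add: algebra_simps)
    with Y have "\<phi> w = (1 - t) *\<^sub>R \<phi> u + t *\<^sub>R \<phi> v"
      by (simp add: prod_eq_iff algebra_simps)
    then show "\<phi> w \<in> closed_segment (\<phi> u) (\<phi> v)"
      using that(6,7) by (auto simp: closed_segment_def t_def)
  qed
  have noncoll: "v = w"
    if e: "{u, v} \<in> ?E" "{u, w} \<in> ?E" and m: "?m u v = ?m u w"
      and side: "X u < X v \<and> X u < X w \<or> X v < X u \<and> X w < X u" for u v w
  proof -
    have V: "v \<in> ?V" "w \<in> ?V" "v \<noteq> u" "w \<noteq> u"
      using e by (auto simp: K_edge_iff K_verts_def)
    \<comment> \<open>Of two points on the same side of \<open>u\<close>, the one nearer in abscissa
      lies on the edge from \<open>u\<close> to the other.\<close>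
    consider "(X w - X u) / (X v - X u) \<le> 1" | "(X v - X u) / (X w - X u) \<le> 1"
      using side linear[of "X v" "X w"] by (auto simp: divide_le_eq)
    then show ?thesis
    proof cases
      case 1
      then show ?thesis using between[OF e(1) V(2)] side m V by (auto simp: zero_le_divide_iff)
    next
      case 2
      then show ?thesis using between[OF e(2) V(1)] side m V by (auto simp: zero_le_divide_iff)
    qed
  qed
  have main: "card P + card Q \<le> Suc (card ?S)"
    if "finite P" "finite Q" "P \<noteq> {}" "Q \<noteq> {}" and sep: "\<And>p q. p \<in> P \<Longrightarrow> q \<in> Q \<Longrightarrow> X p < X q"
      and E: "\<And>p q. p \<in> P \<Longrightarrow> q \<in> Q \<Longrightarrow> {p, q} \<in> ?E" for P Q
  proof -
    have "card P + card Q \<le> Suc (card ((\<lambda>(p, q). ?m p q) ` (P \<times> Q)))"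
    proof (rule card_gradients_separated)
      show "p = p'" if "p \<in> P" "p' \<in> P" "q \<in> Q" "?m p q = ?m p' q" for p p' q
      proof (rule noncoll)
        show "{q, p} \<in> ?E" "{q, p'} \<in> ?E" using E that by (simp_all add: insert_commute)
        show "?m q p = ?m q p'" using that(4) by (simp add: gradient_commute[of X Y q])
      qed (use sep that in blast)
      show "q = q'" if "p \<in> P" "q \<in> Q" "q' \<in> Q" "?m p q = ?m p q'" for p q q'
        by (rule noncoll[OF E E]) (use sep that in blast)+
    qed (use that in auto)
    with m_slopes[of P Q] E show ?thesis by force
  qed
  have "finite (X ` ?A)" "X ` ?A \<noteq> {}" using assms(1) by (auto simp: lessThan_empty_iff)
  then obtain v where v: "v \<in> ?A" "X v = Min (X ` ?A)" using Min_in by (metis (no_types, lifting) imageE)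
  have vmin: "X v \<le> X u" if "u \<in> ?A" for u
    unfolding v(2) using that by (intro Min_le) auto
  define L where "L = {u \<in> ?B. X u < X v}"
  define R where "R = {u \<in> ?B. X v < X u}"
  have fin: "finite L" "finite R" by (simp_all add: L_def R_def)
  have "?B = L \<union> R"
  proof -
    have "X u \<noteq> X v" if "u \<in> ?B" for u using Xinj[of u v] that v(1) by (auto simp: V)
    then show ?thesis by (fastforce simp: L_def R_def)
  qed
  moreover have "L \<inter> R = {}" by (auto simp: L_def R_def)
  moreover have "card ?B = b" "card ?A = a" by (simp_all add: card_image)
  ultimately have b: "b = card L + card R" and a: "card ?A = a"
    using card_Un_disjoint[OF fin] by simp_all
  \<comment> \<open>With \<open>{v}\<close> as the left set, the 1 contributed by \<open>v\<close>
    cancels the \<open>Suc\<close>.\<close>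
  have R: "card R \<le> card ?S"
  proof (cases "R = {}")
    case False
    then have "card {v} + card R \<le> Suc (card ?S)"
      using fin edge v(1) by (intro main) (auto simp: R_def)
    then show ?thesis by simp
  qed simp
  show ?thesis
  proof (cases "L = {}")
    \<comment> \<open>Now all \<open>b\<close> vertices lie to the right of \<open>v\<close>, and a
      + b \<le> 2b finishes the case; this is where \<open>a \<le> b\<close> enters.\<close>
    case True
    then show ?thesis using R b assms(2) by simp
  next
    case False
    \<comment> \<open>Since \<open>v\<close> is leftmost in its class, \<open>L\<close> lies to the
      left of the whole class.\<close>
    have "card L + card ?A \<le> Suc (card ?S)"
    proof (rule main)
      show "X p < X q" if "p \<in> L" "q \<in> ?A" for p q
        using that vmin by (force simp: L_def)
      show "{p, q} \<in> ?E" if "p \<in> L" "q \<in> ?A" for p q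
        using that edge[of q p] by (auto simp: L_def insert_commute)
    qed (use fin False v(1) in auto)
    then show ?thesis using R a b by linarith
  qed
qed

section \<open>The upper bounds\<close>

definition polygon_point :: "nat \<Rightarrow> nat \<Rightarrow> real \<times> real" where
  "polygon_point n k = (cos (2 * pi * k / n), sin (2 * pi * k / n))"

lemma polygon_point_periodic:
  assumes "n > 0"
  shows "polygon_point n (k + n * q) = polygon_point n k"
proof -
  have "2 * pi * real (k + n * q) / n = 2 * pi * k / n + real q * (2 * pi)"
    using assms by (simp add: field_simps)
  then show ?thesis
    using sin.plus_of_nat[of "2 * pi * k / n" q] cos.plus_of_nat[of "2 * pi * k / n" q]
    by (simp add: polygon_point_def)
qed

lemma polygon_point_inj:
  assumes "j < n" "k < n" "polygon_point n j = polygon_point n k"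
  shows "j = k"
proof -
  have "sin (2 * pi * j / n) = sin (2 * pi * k / n) \<and> cos (2 * pi * j / n) = cos (2 * pi * k / n)"
    using assms(3) by (simp add: polygon_point_def)
  then obtain z :: int where "2 * pi * j / n = 2 * pi * k / n + 2 * pi * z"
    using sin_cos_eq_iff by blast
  then have "2 * pi * real j = 2 * pi * (real k + real n * z)"
    using assms(1) by (simp add: field_simps)
  then have "real_of_int (int j) = real_of_int (int k + int n * z)" by simp
  then have "int j = int k + int n * z" by (simp only: of_int_eq_iff)
  then have "int j mod int n = int k mod int n" by simp
  then show ?thesis using assms(1,2) by simp
qed

text \<open>Writing both angles as half-sum plus or minus half-difference gives a direction that
  depends only on \<open>j + k\<close>: chords with equal index sum are parallel.\<close>

lemma polygon_chord:
  assumes "n > 0"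
  shows "polygon_point n k - polygon_point n j =
    (2 * sin (pi * (real k - real j) / n)) *\<^sub>R
      (- sin (pi * real (j + k) / n), cos (pi * real (j + k) / n))"
proof -
  have "2 * pi * k / n = pi * real (j + k) / n + pi * (real k - real j) / n"
    "2 * pi * j / n = pi * real (j + k) / n - pi * (real k - real j) / n"
    using assms by (simp_all add: field_simps)
  then show ?thesis
    unfolding polygon_point_def by (simp add: cos_add sin_add cos_diff sin_diff)
qed

text \<open>An interior point of a segment is strictly closer to the origin than one of the
  endpoints.\<close>

lemma closed_segment_unit_circle:
  fixes p q w :: "real \<times> real"
  assumes "w \<in> closed_segment p q" "norm p = 1" "norm q = 1" "norm w = 1"
  shows "w = p \<or> w = q"
proof (rule ccontr)
  assume "\<not> ?thesis"
  then have "dist 0 w < dist 0 p \<or> dist 0 w < dist 0 q"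
    using assms(1) by (intro dist_decreases_open_segment)
      (auto simp: open_segment_def)
  then show False using assms by simp
qed

lemma norm_polygon_point: "norm (polygon_point n k) = 1"
  by (simp add: polygon_point_def norm_Pair)

lemma slope_polygon_points:
  assumes n: "n > 0" and ne: "polygon_point n j \<noteq> polygon_point n k"
    "polygon_point n j' \<noteq> polygon_point n k'" and "j + k = j' + k'"
  shows "slope (polygon_point n j) (polygon_point n k) = slope (polygon_point n j') (polygon_point n k')"
proof -
  define d where "d = 2 * sin (pi * (real k - real j) / n)"
  define d' where "d' = 2 * sin (pi * (real k' - real j') / n)"
  define w where "w = (- sin (pi * real (j + k) / n), cos (pi * real (j + k) / n))"
  have e: "polygon_point n k - polygon_point n j = d *\<^sub>R w"
    "polygon_point n k' - polygon_point n j' = d' *\<^sub>R w"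
    using polygon_chord[OF n, of k j] polygon_chord[OF n, of k' j'] assms(4)
    by (simp_all add: d_def d'_def w_def)
  then have "d \<noteq> 0" "d' \<noteq> 0" using ne by auto
  then show ?thesis
    using e by (intro slope_parallel[OF ne(2), of "d / d'"]) simp_all
qed

fun alternating_drawing :: "nat \<Rightarrow> nat + nat \<Rightarrow> real \<times> real" where
  "alternating_drawing b (Inl i) = polygon_point (2 * b) (2 * i)"
| "alternating_drawing b (Inr j) = polygon_point (2 * b) (2 * j + 1)"

lemma alternating_drawing:
  assumes "a \<le> b"
  shows "is_drawing (K_verts a b) (K_edges a b) (alternating_drawing b)"
proof (rule is_drawing_K_I)
  have parity: "2 * i \<noteq> Suc (2 * j)" for i j :: nat by presburger
  \<comment> \<open>\<open>f\<close> is the index on the \<open>2 * b\<close>-gon; parity separates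
    the two classes.\<close>
  define f where "f v = (case v of Inl i \<Rightarrow> 2 * i | Inr j \<Rightarrow> 2 * j + 1)" for v :: "nat + nat"
  have f: "alternating_drawing b v = polygon_point (2 * b) (f v)" for v
    by (cases v) (simp_all add: f_def)
  have lt: "f v < 2 * b" if "v \<in> K_verts a b" for v
    using that assms by (auto simp: f_def K_verts_def)
  have "u = v" if "f u = f v" for u v
    using that by (cases u; cases v) (simp_all add: f_def parity parity[symmetric])
  then show "inj_on (alternating_drawing b) (K_verts a b)"
    using polygon_point_inj lt unfolding inj_on_def f by blast
next
  have "norm (alternating_drawing b v) = 1" for v by (cases v) (simp_all add: norm_polygon_point)
  then show "alternating_drawing b w = alternating_drawing b (Inl i) \<or>
      alternating_drawing b w = alternating_drawing b (Inr j)"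
    if "alternating_drawing b w \<in>
      closed_segment (alternating_drawing b (Inl i)) (alternating_drawing b (Inr j))" for i j w
    using closed_segment_unit_circle[OF that] by blast
qed

lemma card_slopes_alternating_drawing:
  assumes "a \<le> b"
  shows "card (slopes (K_edges a b) (alternating_drawing b)) \<le> b"
proof -
  let ?P = "polygon_point (2 * b)"
  have ne: "?P (2 * i) \<noteq> ?P (2 * j + 1)" if "i < b" "j < b" for i j
  proof
    assume "?P (2 * i) = ?P (2 * j + 1)"
    with that have "2 * i = 2 * j + 1" by (intro polygon_point_inj) auto
    then show False by presburger
  qed
  have "slopes (K_edges a b) (alternating_drawing b) \<subseteq> (\<lambda>k. slope (?P 0) (?P (2 * k + 1))) ` {..<b}"
  proof -
    have "slope (?P (2 * i)) (?P (2 * j + 1)) \<in> (\<lambda>k. slope (?P 0) (?P (2 * k + 1))) ` {..<b}"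
      if ij: "i < a" "j < b" for i j
    proof -
      have b: "0 < b" using ij by simp
      \<comment> \<open>The slope depends only on the index sum 2(i + j) + 1, which matters modulo
        2b. Hence i + j matters modulo \<open>b\<close>, leaving \<open>b\<close> classes, each
        represented by a chord from point 0.\<close>
      define k where "k = (i + j) mod b"
      have k: "k < b" using b by (simp add: k_def)
      obtain q where "i + j = k + b * q"
        unfolding k_def by (metis mod_mult_div_eq)
      then have "2 * (i + j) + 1 = (2 * k + 1) + 2 * b * q" by simp
      then have P: "?P (2 * (i + j) + 1) = ?P (2 * k + 1)"
        using polygon_point_periodic[of "2 * b" "2 * k + 1"] b by simp
      have "slope (?P (2 * i)) (?P (2 * j + 1)) = slope (?P 0) (?P (2 * (i + j) + 1))"
      proof (rule slope_polygon_points)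
        show "?P (2 * i) \<noteq> ?P (2 * j + 1)" using ne ij assms by simp
        show "?P 0 \<noteq> ?P (2 * (i + j) + 1)" using ne[of 0 k] k b unfolding P by simp
      qed (use b in auto)
      with P k show ?thesis by auto
    qed
    then show ?thesis by (auto simp: slopes_K_edges)
  qed
  then have "card (slopes (K_edges a b) (alternating_drawing b)) \<le> card {..<b}"
    by (rule surj_card_le[rotated]) simp
  then show ?thesis by simp
qed

section \<open>The drawing on three parallel lines\<close>

text \<open>
  The heights on the line \<open>x = 1\<close> are shifted by \<open>a - k\<close> so that the gradients on both sides range
  over the same integers \<open>1 - k, \<dots>, a - 1\<close>.
\<close>

fun three_line_drawing :: "nat \<Rightarrow> nat \<Rightarrow> nat + nat \<Rightarrow> real \<times> real" where
  "three_line_drawing a k (Inl i) = (0, real i)"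
| "three_line_drawing a k (Inr j) =
     (if j < k then (- 1, real j) else (1, real (j - k) + real a - real k))"

lemma three_line_drawing:
  "is_drawing (K_verts a b) (K_edges a b) (three_line_drawing a k)"
proof (rule is_drawing_K_I)
  show "inj_on (three_line_drawing a k) (K_verts a b)"
    by (auto simp: inj_on_def K_verts_def split: if_splits)
next
  fix i j :: nat and w :: "nat + nat"
  let ?\<phi> = "three_line_drawing a k"
  assume "?\<phi> w \<in> closed_segment (?\<phi> (Inl i)) (?\<phi> (Inr j))"
  then obtain t where t: "0 \<le> t" "t \<le> 1" and w: "?\<phi> w = (1 - t) *\<^sub>R ?\<phi> (Inl i) + t *\<^sub>R ?\<phi> (Inr j)"
    by (auto simp: closed_segment_def)
  have "fst (?\<phi> w) = t * fst (?\<phi> (Inr j))" using w by simp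
  moreover have "fst (?\<phi> w) \<in> {0, 1, - 1}" by (cases w) auto
  \<comment> \<open>The edge ends at abscissa 1 or -1, so \<open>t\<close> is the absolute abscissa
    of \<open>w\<close>; no vertex lies strictly between neighbouring lines.\<close>
  ultimately have "t = 0 \<or> t = 1" using t by (auto split: if_splits)
  then show "?\<phi> w = ?\<phi> (Inl i) \<or> ?\<phi> w = ?\<phi> (Inr j)"
    using w by (auto simp del: three_line_drawing.simps)
qed

lemma card_slopes_three_line_drawing:
  assumes "1 \<le> a" "1 \<le> k" "b \<le> 2 * k"
  shows "card (slopes (K_edges a b) (three_line_drawing a k)) \<le> k + a - 1"
proof -
  let ?I = "{1 - int k..int a - 1}" and ?s = "\<lambda>m. slope (0, 0) (1, real_of_int m)"
  have "slopes (K_edges a b) (three_line_drawing a k) \<subseteq> ?s ` ?I"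
  proof -
    have "slope (three_line_drawing a k (Inl i)) (three_line_drawing a k (Inr j)) \<in> ?s ` ?I"
      if ij: "i < a" "j < b" for i j
    proof (cases "j < k")
      case True
      let ?m = "int i - int j"
      have "slope (0, real i) (- 1, real j) = ?s ?m"
        by (rule slope_parallel[where d = "- 1"]) auto
      moreover have "?m \<in> ?I" using True ij by auto
      ultimately show ?thesis using True imageI[of ?m ?I ?s] by simp
    next
      case False
      let ?m = "int (j - k) + int a - int k - int i"
      have "slope (0, real i) (1, real (j - k) + real a - real k) = ?s ?m"
        by (rule slope_parallel[where d = 1]) auto
      \<comment> \<open>From \<open>b \<le> 2 * k\<close> follows \<open>j - k < k\<close>; the
        extremes of \<open>?m\<close> are then a - k - (a - 1) = 1 - k and (k - 1) + a - k = a -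
        1.\<close>
      moreover have "?m \<in> ?I" using False ij assms by auto
      ultimately show ?thesis using False imageI[of ?m ?I ?s] by simp
    qed
    then show ?thesis by (auto simp: slopes_K_edges simp del: three_line_drawing.simps)
  qed
  then have "card (slopes (K_edges a b) (three_line_drawing a k)) \<le> card ?I"
    by (rule surj_card_le[rotated]) simp
  also have "card ?I = k + a - 1" using assms by simp
  finally show ?thesis .
qed

theorem theorem2:
  fixes a b :: nat
  assumes "1 \<le> a" and "a \<le> b"
  shows "(1 / 2) * (real a + real b - 1) \<le> real (slope_number (K_verts a b) (K_edges a b))
       \<and> int (slope_number (K_verts a b) (K_edges a b))
           \<le> min (int b) (\<lceil>real b / 2\<rceil> + int a - 1)"
proof -
  let ?V = "K_verts a b" and ?E = "K_edges a b"
  \<comment> \<open>The polygon drawing also supplies the existence needed for the minimum to be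
    attained.\<close>
  obtain \<psi> where "is_drawing ?V ?E \<psi>" "slope_number ?V ?E = card (slopes ?E \<psi>)"
    using slope_number_attained[OF alternating_drawing[OF assms(2)]] .
  then have lower: "a + b \<le> Suc (2 * slope_number ?V ?E)"
    using slopes_K_lower_bound[OF assms] by simp
  have upper1: "slope_number ?V ?E \<le> b"
    using slope_number_le[OF alternating_drawing] card_slopes_alternating_drawing assms(2)
    by (meson le_trans)
  define k where "k = nat \<lceil>real b / 2\<rceil>"
  have k: "int k = \<lceil>real b / 2\<rceil>" by (simp add: k_def)
  then have "real b \<le> 2 * real k" by linarith
  then have "b \<le> 2 * k" by linarith
  moreover from this have "1 \<le> k" using assms by linarith
  ultimately have "slope_number ?V ?E \<le> k + a - 1"
    using slope_number_le[OF three_line_drawing] card_slopes_three_line_drawing assms(1)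
    by (meson le_trans)
  then have "int (slope_number ?V ?E) \<le> \<lceil>real b / 2\<rceil> + int a - 1"
    using k assms(1) by linarith
  then show ?thesis using lower upper1 by auto
qed

end
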